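(* The marginal distributions of a marginally stationary AR(1) sequence need not be semi-selfdecomposable, or even infinitely divisible, and the same is true in the integer-valued case. Precisely: (i) There exist $\rho\in(0,1)$ and a marginally stationary AR(1) sequence $\{X_n\}$ of real random variables with coefficient $\rho$ whose marginal distribution is not infinitely divisible and is not SSD($b$) for any $b\in(0,1)$. (ii) There exist $\rho\in(0,1)$ and a marginally stationary integer-valued AR(1) sequence $\{X_n\}$ with coefficient $\rho$ whose marginal distribution on $\{0,1,2,\ldots\}$ is not infinitely divisible (in the discrete sense) and is not discrete SSD($c$) for any $c\in(0,1)$.
   Context: CF means characteristic function and PGF means probability generating function $P(s)=E[s^X]$ of a random variable $X$ with values in $\{0,1,2,\ldots\}$. A CF $f$ (or its distribution on $\mathbf{R}$) is infinitely divisible if for every integer $n\ge 1$ there is a CF $f_n$ with $f=f_n^{\,n}$. A PGF $P$ (or its distribution on $\{0,1,2,\ldots\}$) is infinitely divisible, in the discrete sense, if for every integer $n\ge1$ there is a PGF $P_n$ of a distribution on $\{0,1,2,\ldots\}$ with $P=P_n^{\,n}$. A probability distribution on $\mathbf{R}$ with CF $f$ is semi-selfdecomposable with parameter $b\in(0,1)$, written SSD($b$), if there is an infinitely divisible CF $f_o$ such that $f(t)=f(bt)\,f_o(t)$ for all $t\in\mathbf{R}$. A distribution on $\{0,1,2,\ldots\}$ with PGF $P$ is discrete semi-selfdecomposable with parameter $c\in(0,1)$, written discrete SSD($c$), if there is an infinitely divisible (in the discrete sense) PGF $P_o$ such that $P(s)=P(1-c+cs)\,P_o(s)$ for all $s\in(0,1)$.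 An AR(1) sequence of real random variables with coefficient $\rho\in(0,1)$ is a sequence $\{X_n\}$ satisfying $X_n=\rho X_{n-1}+\varepsilon_n$, where the innovations $\{\varepsilon_n\}$ are i.i.d. and $\varepsilon_n$ is independent of $X_{n-1}$. It is marginally stationary if all $X_n$ have the same distribution. An integer-valued AR(1) sequence with coefficient $\rho\in(0,1)$ is a sequence $\{X_n\}$ of $\{0,1,2,\ldots\}$-valued random variables satisfying $X_n=\rho\circ X_{n-1}+\varepsilon_n$, where the innovations $\{\varepsilon_n\}$ are i.i.d. with values in $\{0,1,2,\ldots\}$, $\varepsilon_n$ is independent of $X_{n-1}$ and of the thinning, and $\rho\circ X$ denotes binomial thinning: conditionally on $X=k$, $\rho\circ X$ is Binomial$(k,\rho)$. It is marginally stationary if all $X_n$ have the same distribution; in terms of PGFs this reads $P(s)=P(1-\rho+\rho s)\,P_\varepsilon(s)$, where $P$ is the PGF of $X_n$ and $P_\varepsilon$ is the PGF of $\varepsilon_n$. *)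

theory Defs
  imports "HOL-Probability.Probability"
begin

definition infinitely_divisible :: "real measure \<Rightarrow> bool" where
  "infinitely_divisible \<mu> \<longleftrightarrow> real_distribution \<mu> \<and>
     (\<forall>n\<ge>1. \<exists>\<nu>. real_distribution \<nu> \<and> (\<forall>t. char \<mu> t = char \<nu> t ^ n))"

definition SSD :: "real \<Rightarrow> real measure \<Rightarrow> bool" where
  "SSD b \<mu> \<longleftrightarrow> 0 < b \<and> b < 1 \<and> real_distribution \<mu> \<and>
     (\<exists>\<nu>. infinitely_divisible \<nu> \<and> (\<forall>t. char \<mu> t = char \<mu> (b * t) * char \<nu> t))"

definition pgf :: "nat pmf \<Rightarrow> real \<Rightarrow> real" where
  "pgf p s = measure_pmf.expectation p (\<lambda>k. s ^ k)"

(* Generating functions are compared on [0,1], where they always converge and which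
   determines the distribution; for \<bar>s\<bar> > 1 a divergent expectation is 0 by convention. *)
definition discrete_infinitely_divisible :: "nat pmf \<Rightarrow> bool" where
  "discrete_infinitely_divisible p \<longleftrightarrow>
     (\<forall>n\<ge>1. \<exists>q :: nat pmf. \<forall>s\<in>{0..1}. pgf p s = pgf q s ^ n)"

definition discrete_SSD :: "real \<Rightarrow> nat pmf \<Rightarrow> bool" where
  "discrete_SSD c p \<longleftrightarrow> 0 < c \<and> c < 1 \<and>
     (\<exists>q. discrete_infinitely_divisible q \<and>
        (\<forall>s\<in>{0<..<1}. pgf p s = pgf p (1 - c + c * s) * pgf q s))"

(* The sequence starts at X 0; the innovations are \<epsilon> 1, \<epsilon> 2, ..., and \<epsilon> 0 is unused. *)
definition AR1 :: "'a measure \<Rightarrow> real \<Rightarrow> (nat \<Rightarrow> 'a \<Rightarrow> real) \<Rightarrow> (nat \<Rightarrow> 'a \<Rightarrow> real) \<Rightarrow> bool" where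
  "AR1 M \<rho> X \<epsilon> \<longleftrightarrow> prob_space M \<and> 0 < \<rho> \<and> \<rho> < 1 \<and>
     (\<forall>n. X n \<in> borel_measurable M) \<and>
     prob_space.indep_vars M (\<lambda>_. borel) \<epsilon> {1..} \<and>
     (\<forall>n\<ge>1. distr M borel (\<epsilon> n) = distr M borel (\<epsilon> 1)) \<and>
     (\<forall>n\<ge>1. prob_space.indep_var M borel (\<epsilon> n) borel (X (n - 1))) \<and>
     (\<forall>n\<ge>1. \<forall>\<omega>\<in>space M. X n \<omega> = \<rho> * X (n - 1) \<omega> + \<epsilon> n \<omega>)"

(* T is a version of the binomial thinning of Y with parameter \<rho>; the thinning involves
   additional randomness, so it is a relation between Y and T and not a function of Y. *)
definition binomial_thinning :: "'a measure \<Rightarrow> real \<Rightarrow> ('a \<Rightarrow> nat) \<Rightarrow> ('a \<Rightarrow> nat) \<Rightarrow> bool" where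
  "binomial_thinning M \<rho> Y T \<longleftrightarrow>
     Y \<in> measurable M (count_space UNIV) \<and> T \<in> measurable M (count_space UNIV) \<and>
     (\<forall>k. measure M {\<omega> \<in> space M. Y \<omega> = k} > 0 \<longrightarrow>
        (\<forall>j. cond_prob M (\<lambda>\<omega>. T \<omega> = j) (\<lambda>\<omega>. Y \<omega> = k) = pmf (binomial_pmf k \<rho>) j))"

(* T n is the thinning of X (n - 1) entering the recursion for X n. Independence of \<epsilon> n from the
   pair (X (n - 1), T n) is stated for the generated sigma-algebras, since indep_var requires
   both variables to have the same value type. *)
definition INAR1 :: "'a measure \<Rightarrow> real \<Rightarrow> (nat \<Rightarrow> 'a \<Rightarrow> nat) \<Rightarrow> (nat \<Rightarrow> 'a \<Rightarrow> nat) \<Rightarrow>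
    (nat \<Rightarrow> 'a \<Rightarrow> nat) \<Rightarrow> bool" where
  "INAR1 M \<rho> X T \<epsilon> \<longleftrightarrow> prob_space M \<and> 0 < \<rho> \<and> \<rho> < 1 \<and>
     (\<forall>n. X n \<in> measurable M (count_space UNIV)) \<and>
     (\<forall>n\<ge>1. binomial_thinning M \<rho> (X (n - 1)) (T n)) \<and>
     prob_space.indep_vars M (\<lambda>_. count_space UNIV) \<epsilon> {1..} \<and>
     (\<forall>n\<ge>1. distr M (count_space UNIV) (\<epsilon> n) = distr M (count_space UNIV) (\<epsilon> 1)) \<and>
     (\<forall>n\<ge>1. prob_space.indep_set M
        (range (\<lambda>A. \<epsilon> n -` A \<inter> space M))
        (range (\<lambda>B. (\<lambda>\<omega>. (X (n - 1) \<omega>, T n \<omega>)) -` B \<inter> space M))) \<and>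
     (\<forall>n\<ge>1. \<forall>\<omega>\<in>space M. X n \<omega> = T n \<omega> + \<epsilon> n \<omega>)"

end

theory Submission
  imports Defs
begin

text \<open>Both counterexamples rest on one obstruction: if \<open>\<phi>\<close> is the characteristic function of an infinitely
divisible law and \<open>\<phi> (2 * t) = 0\<close>, then \<open>\<phi> t = 0\<close> (\<open>infinitely_divisible_char_double\<close>). Indeed every
characteristic function satisfies \<open>2 * \<bar>\<phi> t\<bar>\<^sup>2 - 1 \<le> \<bar>\<phi> (2 * t)\<bar>\<close>, and if \<open>\<phi> t \<noteq> 0\<close>, the \<open>n\<close>-th root of
\<open>\<phi>\<close> has modulus close to 1 at \<open>t\<close> for large \<open>n\<close>, hence does not vanish at \<open>2 * t\<close>. So a law whose
characteristic function vanishes at \<open>2 * t\<close> but not at \<open>t\<close> is not infinitely divisible. Suppose it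
were semi-selfdecomposable, \<open>\<phi> = \<phi>' \<cdot> \<psi>\<close> with \<open>\<phi>'\<close> the characteristic function of the contracted
law. If \<open>\<phi>'\<close> does not vanish at \<open>2 * t\<close>, then \<open>\<psi> (2 * t) = 0\<close>, so \<open>\<psi> t = 0\<close> by the obstruction, and \<open>\<phi> t = 0\<close>, a
contradiction.

Real case. The uniform law on \<open>[0,1]\<close> is stationary for \<open>\<rho> = 1/2\<close> and innovations uniform on \<open>{0, 1/2}\<close>
(prepend a random binary digit). Its characteristic function vanishes at \<open>2\<pi>\<close> and nowhere in
\<open>(0, 2\<pi>)\<close>.

Integer-valued case. The sum of a Bernoulli(1/2) and an independent geometric(1/2) variable has the
generating function \<open>P(z) = (1 + z) / (2(2 - z))\<close>, whose only zero is \<open>-1 = cis \<pi>\<close>. With \<open>\<rho> = 1/3\<close>,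
\<open>P(s) / P(1 - \<rho> + \<rho> s) = (1 + s)(4 - s) / ((5 + s)(2 - s))\<close> has nonnegative power series coefficients
(\<open>innovation_weight_nonneg\<close>), hence is the generating function of an innovation law. Hypotheses on
generating functions over real arguments are carried to the unit circle by uniqueness (\<open>pgf_inj\<close>):
they determine the laws, so they give convolution identities, and these hold for complex arguments.

In both cases the fixed point equation for the marginal law yields an actual process, defined on a
product of countably many coordinate spaces (\<open>stationary_AR1_exists\<close>, \<open>stationary_INAR1_exists\<close>).\<close>

section \<open>Zeros of infinitely divisible characteristic functions\<close>

text \<open>With \<open>u x = iexp (t * x)\<close> and mean \<open>a = char M t\<close>, the difference \<open>char M (2 * t) - a\<^sup>2\<close> is the integral
of \<open>(u - a)\<^sup>2\<close>, whose modulus is at most the variance \<open>1 - \<bar>a\<bar>\<^sup>2\<close> of the unimodular variable \<open>u\<close>.\<close>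
lemma (in real_distribution) norm_char_double:
  "2 * (norm (char M t))\<^sup>2 - 1 \<le> norm (char M (2 * t))"
proof -
  define a where "a = char M t"
  define u where "u x = iexp (t * x)" for x
  have int: "integrable M u"
    unfolding u_def using integrable_iexp[of "\<lambda>x. complex_of_real (t * x)"] by simp
  have int2: "integrable M (\<lambda>x. (u x)\<^sup>2)"
    unfolding u_def using integrable_iexp[of "\<lambda>x. complex_of_real (2 * t * x)"]
    by (simp add: exp_double[symmetric] mult_ac)
  have "char M (2 * t) = (\<integral>x. (u x)\<^sup>2 \<partial>M)"
    unfolding char_def u_def by (simp add: exp_double[symmetric] mult_ac)
  moreover have a: "a = (\<integral>x. u x \<partial>M)"
    by (simp add: a_def char_def u_def)
  ultimately have "char M (2 * t) - a\<^sup>2 = (\<integral>x. (u x)\<^sup>2 - (2 * a * u x - a\<^sup>2) \<partial>M)"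
    using int int2 prob_space by (simp add: power2_eq_square)
  also have "\<dots> = (\<integral>x. (u x - a)\<^sup>2 \<partial>M)"
    by (simp add: power2_diff algebra_simps)
  finally have "norm (char M (2 * t) - a\<^sup>2) \<le> (\<integral>x. norm ((u x - a)\<^sup>2) \<partial>M)"
    by (simp only: integral_norm_bound)
  also have "\<dots> = (\<integral>x. 1 + (norm a)\<^sup>2 - 2 * Re (cnj a * u x) \<partial>M)"
  proof (intro Bochner_Integration.integral_cong refl)
    fix x
    have "norm (u x) = 1" by (simp add: u_def)
    then have "(Re (u x))\<^sup>2 + (Im (u x))\<^sup>2 = 1" by (simp flip: cmod_power2)
    then show "norm ((u x - a)\<^sup>2) = 1 + (norm a)\<^sup>2 - 2 * Re (cnj a * u x)"
      by (simp add: norm_power cmod_power2) (simp add: power2_eq_square algebra_simps)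
  qed
  also have "\<dots> = 1 + (norm a)\<^sup>2 - 2 * Re (cnj a * a)"
  proof -
    have "integrable M (\<lambda>x. cnj a * u x)" using int by simp
    then have "(\<integral>x. Re (cnj a * u x) \<partial>M) = Re (\<integral>x. cnj a * u x \<partial>M)" "integrable M (\<lambda>x. Re (cnj a * u x))"
      by (auto simp only: integral_Re integrable_Re)
    moreover have "(\<integral>x. cnj a * u x \<partial>M) = cnj a * a"
      by (simp add: a)
    ultimately have "(\<integral>x. Re (cnj a * u x) \<partial>M) = Re (cnj a * a)" "integrable M (\<lambda>x. Re (cnj a * u x))"
      by (simp_all only:)
    then show ?thesis using prob_space by (simp del: times_complex.sel)
  qed
  also have "\<dots> = 1 - (norm a)\<^sup>2"
    by (simp add: cmod_power2) (simp add: power2_eq_square)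
  finally have "norm (char M (2 * t) - a\<^sup>2) \<le> 1 - (norm a)\<^sup>2" .
  moreover have "(norm a)\<^sup>2 \<le> norm (char M (2 * t)) + norm (char M (2 * t) - a\<^sup>2)"
    using norm_triangle_sub[of "a\<^sup>2" "char M (2 * t)"] by (simp add: norm_power norm_minus_commute)
  ultimately show ?thesis by (simp add: a_def)
qed

text \<open>The \<open>n\<close>-th roots need no continuity argument: if one vanishes at \<open>2 * t\<close>, the preceding lemma bounds
its squared modulus at \<open>t\<close> by 1/2, so \<open>\<bar>char \<mu> t\<bar>\<^sup>2 \<le> (1/2) ^ n\<close>, which fails for large \<open>n\<close>.\<close>
lemma infinitely_divisible_char_double:
  assumes id: "infinitely_divisible \<mu>" and nz: "char \<mu> t \<noteq> 0"
  shows "char \<mu> (2 * t) \<noteq> 0"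
proof
  assume zero: "char \<mu> (2 * t) = 0"
  obtain n where n: "(1 / 2) ^ n < (norm (char \<mu> t))\<^sup>2"
    using real_arch_pow_inv[of "(norm (char \<mu> t))\<^sup>2" "1 / 2"] nz by auto
  have "norm (char \<mu> t) \<le> 1"
    using id real_distribution.cmod_char_le_1 unfolding infinitely_divisible_def by blast
  then have "(norm (char \<mu> t))\<^sup>2 \<le> 1" by (simp add: power_le_one)
  then have "n \<noteq> 0" using n by (metis not_le power_0)
  then obtain \<nu> where \<nu>: "real_distribution \<nu>" "\<And>t. char \<mu> t = char \<nu> t ^ n"
    using id unfolding infinitely_divisible_def by (metis less_one not_le)
  have "char \<nu> (2 * t) = 0"
    using zero \<nu>(2) by (metis power_eq_0_iff)
  then have "(norm (char \<nu> t))\<^sup>2 \<le> 1 / 2"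
    using real_distribution.norm_char_double[OF \<nu>(1), of t] by simp
  then have "((norm (char \<nu> t))\<^sup>2) ^ n \<le> (1 / 2) ^ n"
    by (intro power_mono) auto
  then have "(norm (char \<mu> t))\<^sup>2 \<le> (1 / 2) ^ n"
    by (simp add: \<nu>(2) norm_power flip: power_mult) (simp add: mult.commute)
  with n show False by simp
qed

text \<open>The contracted factor has no zero at \<open>2 * t\<close>, so the infinitely divisible factor inherits the zero
of \<open>char \<mu>\<close> there and passes it down to \<open>t\<close>.\<close>
lemma not_SSD_if_first_char_zero:
  assumes "0 < b" "b < 1" "0 < t"
    and "char \<mu> (2 * t) = 0" "\<And>s. 0 < s \<Longrightarrow> s < 2 * t \<Longrightarrow> char \<mu> s \<noteq> 0"
  shows "\<not> SSD b \<mu>"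
proof
  assume "SSD b \<mu>"
  then obtain \<nu> where \<nu>: "infinitely_divisible \<nu>" "\<And>t. char \<mu> t = char \<mu> (b * t) * char \<nu> t"
    unfolding SSD_def by blast
  have "char \<mu> (b * (2 * t)) \<noteq> 0" using assms by (intro assms(5)) auto
  then have "char \<nu> (2 * t) = 0" using \<nu>(2)[of "2 * t"] assms(4) by simp
  then have "char \<nu> t = 0" using infinitely_divisible_char_double[OF \<nu>(1)] by blast
  then have "char \<mu> t = 0" using \<nu>(2)[of t] by simp
  then show False using assms by simp
qed

section \<open>The uniform law on the unit interval\<close>

abbreviation unif :: "real measure" where
  "unif \<equiv> uniform_measure lborel {0..1}"

definition half_coin :: "real measure" where
  "half_coin = distr (measure_pmf (bernoulli_pmf (1 / 2))) borel (\<lambda>b. if b then 1 / 2 else 0)"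

lemma real_distribution_unif: "real_distribution unif"
  unfolding real_distribution_def real_distribution_axioms_def
  by (auto intro!: prob_space_uniform_measure)

lemma real_distribution_half_coin: "real_distribution half_coin"
  unfolding half_coin_def real_distribution_def real_distribution_axioms_def
  by (auto intro!: prob_space.prob_space_distr prob_space_measure_pmf)

lemma char_half_coin: "char half_coin t = (1 + iexp (t / 2)) / 2"
  unfolding char_def half_coin_def
  by (subst integral_distr)
     (auto simp: integral_measure_pmf[of UNIV] UNIV_bool scaleR_conv_of_real field_simps)

lemma char_unif:
  assumes "t \<noteq> 0"
  shows "char unif t = (iexp t - 1) / (\<i> * of_real t)"
proof -
  have unif: "unif = density lborel (\<lambda>x. ennreal (indicator {0..1} x))"
    unfolding uniform_measure_def by (simp add: ennreal_indicator divide_ennreal_def)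
  have "char unif t = (\<integral>x. indicator {0..1} x *\<^sub>R iexp (t * x) \<partial>lborel)"
    unfolding char_def unif by (subst integral_density) auto
  also have "\<dots> = iexp (t * 1) / (\<i> * of_real t) - iexp (t * 0) / (\<i> * of_real t)"
  proof (rule integral_FTC_atLeastAtMost)
    have "((\<lambda>z. exp (\<i> * (of_real t * z)) / (\<i> * of_real t)) has_field_derivative
        exp (\<i> * (of_real t * z))) (at z)" for z
      using assms by (auto intro!: derivative_eq_intros simp: complex_eq_iff)
    then show "((\<lambda>x. iexp (t * x) / (\<i> * of_real t)) has_vector_derivative iexp (t * x))
        (at x within {0..1})" for x
      using has_vector_derivative_real_field[of "\<lambda>z. exp (\<i> * (of_real t * z)) / (\<i> * of_real t)"]
      by simp
  qed (auto intro!: continuous_intros)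
  finally show ?thesis by (simp add: diff_divide_distrib)
qed

lemma char_unif_recursion: "char unif t = char unif (1 / 2 * t) * char half_coin t"
proof (cases "t = 0")
  case True
  then show ?thesis
    using real_distribution.char_zero[OF real_distribution_unif] by (simp add: char_half_coin)
next
  case False
  have "iexp t = iexp (t / 2) ^ 2"
    by (simp flip: exp_double)
  then show ?thesis
    using False by (simp add: char_unif char_half_coin field_simps power2_eq_square)
qed

lemma char_unif_2pi: "char unif (2 * pi) = 0"
  using exp_two_pi_i by (subst char_unif) (auto simp: mult_ac)

lemma char_unif_nonzero:
  assumes "0 < t" "t < 2 * pi"
  shows "char unif t \<noteq> 0"
proof
  assume "char unif t = 0"
  then have "exp (\<i> * of_real t) = 1" using assms by (auto simp: char_unif)
  then obtain k :: int where k: "t = of_int (2 * k) * pi"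
    by (auto simp: exp_eq_1)
  then have "0 < real_of_int k" "real_of_int k < 1"
    using assms by (auto simp: zero_less_mult_iff)
  then show False by simp
qed

section \<open>Independent coordinates of an infinite product\<close>

lemma indep_vars_PiM_coordinates:
  fixes L :: "'i \<Rightarrow> 'a measure"
  assumes "\<And>i. prob_space (L i)"
  shows "prob_space.indep_vars (PiM UNIV L) L (\<lambda>i \<omega>. \<omega> i) UNIV"
proof -
  interpret prob_space "PiM UNIV L" by (intro prob_space_PiM assms)
  have "distr (PiM UNIV L) (L i) (\<lambda>\<omega>. \<omega> i) = L i" for i
    by (rule distr_PiM_component) (simp_all add: assms)
  moreover have "distr (PiM UNIV L) (PiM UNIV L) (\<lambda>\<omega>. restrict \<omega> UNIV) = PiM UNIV L"
    unfolding restrict_UNIV by (rule distr_id)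
  ultimately show ?thesis
    by (subst indep_vars_iff_distr_eq_PiM') simp_all
qed

text \<open>The conditions \<open>f (restrict \<omega> A) = f \<omega>\<close> say that \<open>f\<close> depends only on the coordinates in \<open>A\<close>; they let the
same function be read both on the partial product over \<open>A\<close> and on the full product.\<close>
lemma indep_var_PiM_disjoint:
  fixes L :: "'i \<Rightarrow> 'a measure"
  assumes L: "\<And>i. prob_space (L i)" and "A \<inter> B = {}"
    and f: "f \<in> measurable (PiM A L) N" "\<And>\<omega>. f (restrict \<omega> A) = f \<omega>"
    and g: "g \<in> measurable (PiM B L) N'" "\<And>\<omega>. g (restrict \<omega> B) = g \<omega>"
  shows "prob_space.indep_var (PiM UNIV L) N f N' g"
proof -
  interpret prob_space "PiM UNIV L" by (intro prob_space_PiM L)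
  have "indep_var N (f \<circ> (\<lambda>\<omega>. restrict (\<lambda>i. \<omega> i) A)) N' (g \<circ> (\<lambda>\<omega>. restrict (\<lambda>i. \<omega> i) B))"
    using assms
    by (intro indep_var_compose[OF indep_var_restrict[OF indep_vars_PiM_coordinates[OF L]]]) auto
  then show ?thesis by (simp add: comp_def f g)
qed

section \<open>Stationary autoregressive sequences\<close>

primrec ar_path :: "real \<Rightarrow> nat \<Rightarrow> (nat \<Rightarrow> real) \<Rightarrow> real" where
  "ar_path \<rho> 0 \<omega> = \<omega> 0"
| "ar_path \<rho> (Suc n) \<omega> = \<rho> * ar_path \<rho> n \<omega> + \<omega> (Suc n)"

lemma ar_path_restrict: "{..n} \<subseteq> A \<Longrightarrow> ar_path \<rho> n (restrict \<omega> A) = ar_path \<rho> n \<omega>"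
  by (induction n) (auto simp: subset_eq)

lemma measurable_ar_path:
  assumes "\<And>i. sets (L i) = sets borel" "{..n} \<subseteq> A"
  shows "ar_path \<rho> n \<in> borel_measurable (PiM A L)"
  using assms(2)
proof (induction n)
  have coord: "(\<lambda>\<omega>. \<omega> i) \<in> borel_measurable (PiM A L)" if "i \<in> A" for i
    using measurable_component_singleton[OF that, of L] assms(1)
    by (simp cong: measurable_cong_sets)
  { case 0
    then show ?case using coord by simp
  next
    case (Suc n)
    have "{..n} \<subseteq> A" "Suc n \<in> A" using Suc.prems by auto
    then show ?case using Suc.IH coord[of "Suc n"] by simp }
qed

lemma char_distr_scale:
  assumes "X \<in> borel_measurable M"
  shows "char (distr M borel (\<lambda>\<omega>. c * X \<omega>)) t = char (distr M borel X) (c * t)"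
  unfolding char_def using assms by (simp add: integral_distr mult_ac)

text \<open>Coordinate 0 of the product is the starting value and coordinate \<open>n \<ge> 1\<close> the \<open>n\<close>-th innovation. The
assumed identity of characteristic functions makes \<open>\<mu>\<close> invariant under one step of the recursion.\<close>
lemma stationary_AR1_exists:
  assumes \<mu>: "real_distribution \<mu>" and \<nu>: "real_distribution \<nu>" and \<rho>: "0 < \<rho>" "\<rho> < 1"
    and char: "\<And>t. char \<mu> t = char \<mu> (\<rho> * t) * char \<nu> t"
  shows "\<exists>(M :: (nat \<Rightarrow> real) measure) X \<epsilon>. AR1 M \<rho> X \<epsilon> \<and> (\<forall>n. distr M borel (X n) = \<mu>)"
proof -
  define L where "L n = (if n = 0 then \<mu> else \<nu>)" for n :: nat
  define M where "M = PiM UNIV L"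
  define \<epsilon> where "\<epsilon> n \<omega> = \<omega> n" for n and \<omega> :: "nat \<Rightarrow> real"
  interpret \<mu>: real_distribution \<mu> by fact
  interpret \<nu>: real_distribution \<nu> by fact
  have L: "prob_space (L i)" and sets_L: "sets (L i) = sets borel" for i
    unfolding L_def by (auto intro: \<mu>.prob_space_axioms \<nu>.prob_space_axioms)
  interpret M: prob_space M unfolding M_def by (intro prob_space_PiM L)
  have X_meas: "ar_path \<rho> n \<in> borel_measurable M" for n
    unfolding M_def by (rule measurable_ar_path) (auto simp: sets_L)
  have X_meas': "ar_path \<rho> n \<in> borel_measurable (PiM {..n} L)" for n
    by (rule measurable_ar_path) (auto simp: sets_L)
  have \<epsilon>_meas: "\<epsilon> n \<in> borel_measurable (PiM A L)" if "n \<in> A" for n A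
    using measurable_component_singleton[OF that, of L] sets_L
    by (simp add: \<epsilon>_def[abs_def] cong: measurable_cong_sets)
  have distr_\<epsilon>: "distr M borel (\<epsilon> n) = L n" for n
    using distr_PiM_component[of UNIV L n] L sets_L
    by (simp add: M_def \<epsilon>_def[abs_def] cong: distr_cong)
  have indep: "M.indep_var borel (\<epsilon> (Suc n)) borel (ar_path \<rho> n)" for n
    unfolding M_def
    by (rule indep_var_PiM_disjoint[where A="{Suc n}" and B="{..n}"])
       (use X_meas' \<epsilon>_meas in \<open>auto simp: L ar_path_restrict \<epsilon>_def\<close>)
  have "M.indep_vars L \<epsilon> UNIV"
    unfolding M_def \<epsilon>_def[abs_def] by (rule indep_vars_PiM_coordinates[OF L])
  then have "M.indep_vars (\<lambda>_. borel) \<epsilon> {1..}"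
    using M.indep_vars_compose2[of L \<epsilon> UNIV "\<lambda>_ x. x" "\<lambda>_. borel"] sets_L
    by (auto intro: M.indep_vars_subset cong: measurable_cong_sets)
  then have "AR1 M \<rho> (ar_path \<rho>) \<epsilon>"
    unfolding AR1_def
  proof (intro conjI allI impI ballI)
    fix n :: nat assume "1 \<le> n"
    then obtain m where m: "n = Suc m" by (cases n) auto
    show "distr M borel (\<epsilon> n) = distr M borel (\<epsilon> 1)"
      unfolding distr_\<epsilon> by (simp add: L_def m)
    show "M.indep_var borel (\<epsilon> n) borel (ar_path \<rho> (n - 1))"
      using indep by (simp add: m)
    show "ar_path \<rho> n \<omega> = \<rho> * ar_path \<rho> (n - 1) \<omega> + \<epsilon> n \<omega>" for \<omega>
      by (simp add: m \<epsilon>_def)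
  qed (use \<rho> M.prob_space_axioms X_meas in auto)
  moreover have "distr M borel (ar_path \<rho> n) = \<mu>" for n
  proof (induction n)
    case 0
    have "ar_path \<rho> 0 = \<epsilon> 0" by (simp add: fun_eq_iff \<epsilon>_def)
    then show ?case using distr_\<epsilon>[of 0] by (simp add: L_def)
  next
    case (Suc n)
    have ind: "M.indep_var borel (\<lambda>\<omega>. \<rho> * ar_path \<rho> n \<omega>) borel (\<epsilon> (Suc n))"
      unfolding M_def
      by (rule indep_var_PiM_disjoint[where B="{Suc n}" and A="{..n}"])
         (use X_meas' \<epsilon>_meas in \<open>auto simp: L ar_path_restrict \<epsilon>_def\<close>)
    show ?case
    proof (rule Levy_uniqueness)
      show "real_distribution (distr M borel (ar_path \<rho> (Suc n)))"
        using X_meas by (rule M.real_distribution_distr)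
      show "char (distr M borel (ar_path \<rho> (Suc n))) = char \<mu>"
      proof
        fix t
        have "ar_path \<rho> (Suc n) = (\<lambda>\<omega>. \<rho> * ar_path \<rho> n \<omega> + \<epsilon> (Suc n) \<omega>)"
          by (simp add: fun_eq_iff \<epsilon>_def)
        then have "char (distr M borel (ar_path \<rho> (Suc n))) t
            = char (distr M borel (\<lambda>\<omega>. \<rho> * ar_path \<rho> n \<omega>)) t * char (distr M borel (\<epsilon> (Suc n))) t"
          using M.char_distr_add[OF ind, of t] by simp
        also have "\<dots> = char \<mu> (\<rho> * t) * char \<nu> t"
          unfolding distr_\<epsilon> char_distr_scale[OF X_meas] Suc.IH by (simp add: L_def)
        finally show "char (distr M borel (ar_path \<rho> (Suc n))) t = char \<mu> t"
          unfolding char[of t] .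
      qed
    qed (rule \<mu>)
  qed
  ultimately show ?thesis by blast
qed

section \<open>Complex generating functions\<close>

text \<open>The generating function is needed at the complex arguments \<open>-1\<close> and \<open>\<i>\<close>; on the unit circle it is
the characteristic function (\<open>char_law\<close> below).\<close>
definition cpgf :: "nat pmf \<Rightarrow> complex \<Rightarrow> complex" where
  "cpgf p z = measure_pmf.expectation p (\<lambda>k. z ^ k)"

definition add_pmf :: "nat pmf \<Rightarrow> nat pmf \<Rightarrow> nat pmf" where
  "add_pmf p q = bind_pmf p (\<lambda>x. map_pmf ((+) x) q)"

definition thin_pmf :: "real \<Rightarrow> nat pmf \<Rightarrow> nat pmf" where
  "thin_pmf c p = bind_pmf p (\<lambda>k. binomial_pmf k c)"

definition law :: "nat pmf \<Rightarrow> real measure" where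
  "law p = distr (measure_pmf p) borel real"

lemma integral_bind_pmf_bounded:
  fixes f :: "'b \<Rightarrow> complex"
  assumes bound: "\<And>y. norm (f y) \<le> B"
  shows "measure_pmf.expectation (bind_pmf p g) f = (\<integral>x. measure_pmf.expectation (g x) f \<partial>p)"
proof -
  have real: "measure_pmf.expectation (bind_pmf p g) h = (\<integral>x. measure_pmf.expectation (g x) h \<partial>p)"
    if "\<And>y. \<bar>h y\<bar> \<le> B" for h :: "'b \<Rightarrow> real"
    unfolding measure_pmf_bind
    by (rule integral_bind[where K="count_space UNIV" and B=B and B'=1])
       (use that in \<open>auto simp: measure_pmf.emeasure_space_1 measure_subprob intro: measure_pmf.finite_measure_axioms\<close>)
  have int: "integrable (measure_pmf q) f" for q
    using bound by (intro measure_pmf.integrable_const_bound[where B=B]) auto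
  have int': "integrable (measure_pmf p) (\<lambda>x. measure_pmf.expectation (g x) f)"
    using bound
    by (intro measure_pmf.integrable_const_bound[where B=B] AE_I2 order_trans[OF integral_norm_bound]
        measure_pmf.integral_le_const integrable_norm int) auto
  have "\<bar>Re (f y)\<bar> \<le> B" "\<bar>Im (f y)\<bar> \<le> B" for y
    using bound[of y] abs_Re_le_cmod[of "f y"] abs_Im_le_cmod[of "f y"] by linarith+
  then show ?thesis
    by (intro complex_eqI)
       (simp_all add: integral_Re[OF int, symmetric] integral_Im[OF int, symmetric]
          integral_Re[OF int', symmetric] integral_Im[OF int', symmetric] real)
qed

lemma cpgf_sums:
  assumes "norm z \<le> 1"
  shows "(\<lambda>k. of_real (pmf p k) * z ^ k) sums cpgf p z"
proof -
  have *: "integrable (measure_pmf p) (\<lambda>k. z ^ k)"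
    using assms by (intro measure_pmf.integrable_const_bound[where B=1])
      (auto simp: norm_power power_le_one)
  have "integrable (count_space UNIV) (\<lambda>k. pmf p k *\<^sub>R z ^ k)"
    using * unfolding measure_pmf_eq_density by (subst (asm) integrable_density) auto
  moreover have "cpgf p z = (\<integral>k. pmf p k *\<^sub>R z ^ k \<partial>count_space UNIV)"
    unfolding cpgf_def measure_pmf_eq_density by (subst integral_density) auto
  ultimately show ?thesis
    using sums_integral_count_space_nat[of "\<lambda>k. pmf p k *\<^sub>R z ^ k"] by (simp add: scaleR_conv_of_real)
qed

lemma cpgf_of_real: "cpgf p (of_real s) = of_real (pgf p s)"
  unfolding cpgf_def pgf_def
  by (simp add: integral_complex_of_real[symmetric] del: integral_complex_of_real)

lemma pgf_sums:
  assumes "\<bar>s\<bar> \<le> 1"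
  shows "(\<lambda>k. pmf p k * s ^ k) sums pgf p s"
  using cpgf_sums[of "of_real s" p] assms unfolding cpgf_of_real
  by (simp flip: of_real_power of_real_mult add: sums_of_real_iff)

lemma cpgf_add_pmf:
  assumes "norm z \<le> 1"
  shows "cpgf (add_pmf p q) z = cpgf p z * cpgf q z"
proof -
  have "cpgf (add_pmf p q) z = (\<integral>x. measure_pmf.expectation (map_pmf ((+) x) q) (\<lambda>k. z ^ k) \<partial>p)"
    unfolding cpgf_def add_pmf_def
    using assms by (intro integral_bind_pmf_bounded[where B=1]) (auto simp: norm_power power_le_one)
  also have "\<dots> = cpgf p z * cpgf q z"
    by (simp add: cpgf_def power_add)
  finally show ?thesis .
qed

lemma cpgf_binomial_pmf:
  assumes "c \<in> {0..1}"
  shows "cpgf (binomial_pmf n c) z = (1 - of_real c + of_real c * z) ^ n"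
proof -
  have "cpgf (binomial_pmf n c) z
      = (\<Sum>k\<le>n. of_nat (n choose k) * (of_real c * z) ^ k * (1 - of_real c) ^ (n - k))"
    unfolding cpgf_def using assms
    by (subst expectation_binomial_pmf') (auto intro!: sum.cong simp: scaleR_conv_of_real power_mult_distrib)
  also have "\<dots> = (of_real c * z + (1 - of_real c)) ^ n"
    by (simp add: binomial_ring)
  finally show ?thesis by (simp add: add.commute)
qed

lemma cpgf_thin_pmf:
  assumes "norm z \<le> 1" "c \<in> {0..1}"
  shows "cpgf (thin_pmf c p) z = cpgf p (1 - of_real c + of_real c * z)"
proof -
  have "cpgf (thin_pmf c p) z = (\<integral>k. cpgf (binomial_pmf k c) z \<partial>p)"
    unfolding thin_pmf_def cpgf_def
    using assms by (intro integral_bind_pmf_bounded[where B=1]) (auto simp: norm_power power_le_one)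
  then show ?thesis
    unfolding cpgf_binomial_pmf[OF assms(2)] by (simp only: cpgf_def)
qed

lemma pgf_add_thin:
  assumes "\<bar>s\<bar> \<le> 1" "c \<in> {0..1}"
  shows "pgf (add_pmf (thin_pmf c p) q) s = pgf p (1 - c + c * s) * pgf q s"
proof -
  have "complex_of_real (pgf (add_pmf (thin_pmf c p) q) s) = of_real (pgf p (1 - c + c * s) * pgf q s)"
    using assms cpgf_of_real[of p "1 - c + c * s"]
    by (simp add: cpgf_add_pmf cpgf_thin_pmf flip: cpgf_of_real)
  then show ?thesis by (simp only: of_real_eq_iff)
qed

text \<open>An identity theorem that uses the power series only to the right of 0: once the coefficients below
\<open>n\<close> vanish, the series divided by \<open>s ^ n\<close> is 0 for \<open>s > 0\<close> and tends to \<open>a n\<close> as \<open>s\<close> decreases to 0.\<close>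
lemma powser_eq_0:
  fixes a :: "nat \<Rightarrow> real"
  assumes bdd: "\<And>k. \<bar>a k\<bar> \<le> B"
    and zero: "\<And>s. 0 < s \<Longrightarrow> s < 1 \<Longrightarrow> (\<lambda>k. a k * s ^ k) sums 0"
  shows "a n = 0"
proof (induction n rule: less_induct)
  case (less n)
  define b where "b k = a (k + n)" for k
  have sm: "summable (\<lambda>k. b k * s ^ k)" if "norm s < 1" for s
  proof (rule summable_comparison_test')
    show "summable (\<lambda>k. B * \<bar>s\<bar> ^ k)"
      using that by (intro summable_mult summable_geometric) auto
    show "norm (b k * s ^ k) \<le> B * \<bar>s\<bar> ^ k" for k
      using bdd[of "k + n"] by (auto simp: b_def abs_mult power_abs intro!: mult_right_mono)
  qed
  have "((\<lambda>s. \<Sum>k. b k * s ^ k) \<longlongrightarrow> b 0) (at 0)"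
    by (rule powser_limit_0[of 1]) (auto intro!: summable_sums sm)
  then have lim: "((\<lambda>s. \<Sum>k. b k * s ^ k) \<longlongrightarrow> b 0) (at_right 0)"
    by (rule filterlim_mono) (auto simp: at_within_le_at)
  have "(\<Sum>k. b k * s ^ k) = 0" if s: "0 < s" "s < 1" for s
  proof -
    have "(\<lambda>k. a (k + n) * s ^ (k + n)) sums (0 - (\<Sum>k<n. a k * s ^ k))"
      using zero[OF s] by (rule sums_split_initial_segment)
    then have "(\<lambda>k. s ^ n * (b k * s ^ k)) sums 0"
      using less by (simp add: b_def power_add mult_ac)
    then have "(\<lambda>k. b k * s ^ k) sums 0"
      using s sums_mult_iff[of "s ^ n" "\<lambda>k. b k * s ^ k" 0] by simp
    then show ?thesis by (simp add: sums_iff)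
  qed
  then have "((\<lambda>s. \<Sum>k. b k * s ^ k) \<longlongrightarrow> 0) (at_right 0)"
    by (intro tendsto_eventually eventually_at_rightI[of 0 1]) auto
  with lim have "b 0 = 0"
    by (intro tendsto_unique[OF _ lim]) auto
  then show ?case by (simp add: b_def)
qed

lemma pgf_inj:
  assumes "\<And>s. 0 < s \<Longrightarrow> s < 1 \<Longrightarrow> pgf p s = pgf q s"
  shows "p = q"
proof (rule pmf_eqI)
  fix n
  have "pmf p n - pmf q n = 0"
  proof (rule powser_eq_0[where B = 1 and n = n])
    fix k show "\<bar>pmf p k - pmf q k\<bar> \<le> 1"
      using pmf_le_1[of p k] pmf_le_1[of q k] pmf_nonneg[of p k] pmf_nonneg[of q k] by linarith
  next
    fix s :: real assume "0 < s" "s < 1"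
    then show "(\<lambda>k. (pmf p k - pmf q k) * s ^ k) sums 0"
      using sums_diff[OF pgf_sums[of s p] pgf_sums[of s q]] assms by (simp add: left_diff_distrib)
  qed
  then show "pmf p n = pmf q n" by simp
qed

lemma real_distribution_law: "real_distribution (law p)"
  unfolding law_def real_distribution_def real_distribution_axioms_def
  by (auto intro!: prob_space.prob_space_distr prob_space_measure_pmf)

lemma char_law: "char (law p) t = cpgf p (cis t)"
  unfolding char_def law_def cpgf_def
  by (subst integral_distr) (auto simp: cis_conv_exp exp_of_nat_mult[symmetric] mult_ac intro!: Bochner_Integration.integral_cong)

lemma cpgf_power:
  obtains r where "\<And>z. norm z \<le> 1 \<Longrightarrow> cpgf r z = cpgf q z ^ n"
proof -
  have "\<exists>r. \<forall>z. norm z \<le> 1 \<longrightarrow> cpgf r z = cpgf q z ^ n"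
  proof (induction n)
    case 0
    show ?case by (rule exI[of _ "return_pmf 0"]) (simp add: cpgf_def)
  next
    case (Suc n)
    then obtain r where "\<forall>z. norm z \<le> 1 \<longrightarrow> cpgf r z = cpgf q z ^ n" ..
    then show ?case
      by (intro exI[of _ "add_pmf q r"]) (simp add: cpgf_add_pmf)
  qed
  then show ?thesis using that by blast
qed

text \<open>The identity of generating functions is known only on \<open>[0,1]\<close>, while characteristic functions need it
on the unit circle. Realising the \<open>n\<close>-th power by an \<open>n\<close>-fold convolution turns it into an equality
of laws, by uniqueness.\<close>
lemma infinitely_divisible_law:
  assumes "discrete_infinitely_divisible p"
  shows "infinitely_divisible (law p)"
  unfolding infinitely_divisible_def
proof (intro conjI allI impI)
  show "real_distribution (law p)" by (rule real_distribution_law)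
  fix n :: nat assume "n \<ge> 1"
  then obtain q where q: "\<forall>s\<in>{0..1}. pgf p s = pgf q s ^ n"
    using assms unfolding discrete_infinitely_divisible_def by blast
  obtain r where r: "\<And>z. norm z \<le> 1 \<Longrightarrow> cpgf r z = cpgf q z ^ n"
    using cpgf_power[of q n] by blast
  have "p = r"
  proof (rule pgf_inj)
    fix s :: real assume "0 < s" "s < 1"
    then have "complex_of_real (pgf p s) = of_real (pgf r s)"
      using q r[of "of_real s"] by (simp add: cpgf_of_real)
    then show "pgf p s = pgf r s" by (simp only: of_real_eq_iff)
  qed
  then show "\<exists>\<nu>. real_distribution \<nu> \<and> (\<forall>t. char (law p) t = char \<nu> t ^ n)"
    using r by (intro exI[of _ "law q"]) (simp add: char_law real_distribution_law)
qed

section \<open>Stationary integer-valued autoregressive sequences\<close>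

text \<open>Choosing an element of a family \<open>Z\<close> at a random index \<open>Y\<close> independent of each member realises the
monadic bind. It serves twice: for thinning (the family of binomial variables) and for adding an
independent variable (the family of its translates).\<close>
lemma (in prob_space)
  fixes Y :: "'a \<Rightarrow> nat" and Z :: "nat \<Rightarrow> 'a \<Rightarrow> nat"
  assumes indep: "\<And>k. indep_var (count_space UNIV) Y (count_space UNIV) (Z k)"
    and Y: "distr M (count_space UNIV) Y = measure_pmf p"
    and Z: "\<And>k. distr M (count_space UNIV) (Z k) = measure_pmf (g k)"
  shows prob_mixture: "prob {\<omega> \<in> space M. Z (Y \<omega>) \<omega> = j \<and> Y \<omega> = k} = pmf p k * pmf (g k) j"
    and distr_mixture: "distr M (count_space UNIV) (\<lambda>\<omega>. Z (Y \<omega>) \<omega>) = measure_pmf (bind_pmf p g)"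
proof -
  have Y_meas [measurable]: "Y \<in> measurable M (count_space UNIV)"
    and Z_meas [measurable]: "Z k \<in> measurable M (count_space UNIV)" for k
    using indep[of k] by (auto simp: indep_var_eq)
  have pmfY: "prob (Y -` {k} \<inter> space M) = pmf p k" for k
    using arg_cong[OF Y, of "\<lambda>N. measure N {k}"] by (simp add: measure_distr measure_pmf_single)
  have pmfZ: "prob (Z k -` {j} \<inter> space M) = pmf (g k) j" for k j
    using arg_cong[OF Z[of k], of "\<lambda>N. measure N {j}"] by (simp add: measure_distr measure_pmf_single)
  have joint: "prob {\<omega> \<in> space M. Z (Y \<omega>) \<omega> = j \<and> Y \<omega> = k} = pmf p k * pmf (g k) j" for j k
  proof -
    have "{\<omega> \<in> space M. Z (Y \<omega>) \<omega> = j \<and> Y \<omega> = k} = (\<lambda>\<omega>. (Y \<omega>, Z k \<omega>)) -` ({k} \<times> {j}) \<inter> space M"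
      by auto
    then show ?thesis
      using indep_varD[OF indep[of k], of "{k}" "{j}"] by (simp add: pmfY pmfZ)
  qed
  show "prob {\<omega> \<in> space M. Z (Y \<omega>) \<omega> = j \<and> Y \<omega> = k} = pmf p k * pmf (g k) j"
    by (rule joint)
  have mix [measurable]: "(\<lambda>\<omega>. Z (Y \<omega>) \<omega>) \<in> measurable M (count_space UNIV)"
    by (rule measurable_compose_countable) measurable
  show "distr M (count_space UNIV) (\<lambda>\<omega>. Z (Y \<omega>) \<omega>) = measure_pmf (bind_pmf p g)"
  proof (rule measure_eqI_countable[where A=UNIV])
    fix j
    have "emeasure (distr M (count_space UNIV) (\<lambda>\<omega>. Z (Y \<omega>) \<omega>)) {j}
        = emeasure M (\<Union>k. {\<omega> \<in> space M. Z (Y \<omega>) \<omega> = j \<and> Y \<omega> = k})"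
      by (subst emeasure_distr) (auto intro!: arg_cong[where f="emeasure M"])
    also have "\<dots> = (\<Sum>k. emeasure M {\<omega> \<in> space M. Z (Y \<omega>) \<omega> = j \<and> Y \<omega> = k})"
      by (intro suminf_emeasure[symmetric]) (auto simp: disjoint_family_on_def)
    also have "\<dots> = (\<Sum>k. ennreal (pmf p k) * ennreal (pmf (g k) j))"
      by (simp add: emeasure_eq_measure joint ennreal_mult)
    also have "\<dots> = emeasure (measure_pmf (bind_pmf p g)) {j}"
      unfolding emeasure_pmf_single ennreal_pmf_bind nn_integral_measure_pmf
        nn_integral_count_space_nat ..
    finally show "emeasure (distr M (count_space UNIV) (\<lambda>\<omega>. Z (Y \<omega>) \<omega>)) {j}
        = emeasure (measure_pmf (bind_pmf p g)) {j}" .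
  qed auto
qed

text \<open>A doubly indexed family of independent natural numbers, packed into one sequence of reals. Row 0 holds
the starting value in column 0; in row \<open>n \<ge> 1\<close>, column 0 holds the innovation at time \<open>n\<close> and column
\<open>Suc k\<close> a Binomial(\<open>k\<close>, \<open>\<rho>\<close>) variable, which is the thinning in the event that the previous value is \<open>k\<close>.\<close>
definition coord :: "nat \<Rightarrow> nat \<Rightarrow> (nat \<Rightarrow> real) \<Rightarrow> nat" where
  "coord n k \<omega> = nat \<lfloor>\<omega> (prod_encode (n, k))\<rfloor>"

primrec inar_path :: "nat \<Rightarrow> (nat \<Rightarrow> real) \<Rightarrow> nat" where
  "inar_path 0 \<omega> = coord 0 0 \<omega>"
| "inar_path (Suc n) \<omega> = coord (Suc n) (Suc (inar_path n \<omega>)) \<omega> + coord (Suc n) 0 \<omega>"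

text \<open>The coordinates that the path may inspect up to time \<open>n\<close>, for some values of its predecessors.\<close>
definition past :: "nat \<Rightarrow> nat set" where
  "past n = prod_encode ` ({..n} \<times> UNIV)"

lemma past_iff [simp]: "prod_encode (m, k) \<in> past n \<longleftrightarrow> m \<le> n"
  by (auto simp: past_def inj_image_mem_iff[OF inj_prod_encode])

lemma past_mono: "past n \<subseteq> past (Suc n)"
  by (auto simp: past_def)

lemma coord_restrict: "prod_encode (n, k) \<in> A \<Longrightarrow> coord n k (restrict \<omega> A) = coord n k \<omega>"
  by (simp add: coord_def)

lemma inar_path_restrict: "past n \<subseteq> A \<Longrightarrow> inar_path n (restrict \<omega> A) = inar_path n \<omega>"
proof (induction n)
  case 0
  then have "prod_encode (0, 0) \<in> A" by (auto simp: subset_iff)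
  then show ?case by (simp add: coord_restrict del: restrict_apply)
next
  case (Suc n)
  have "prod_encode (Suc n, k) \<in> A" for k using Suc.prems by (auto simp: subset_iff)
  moreover have "past n \<subseteq> A" using Suc.prems past_mono by blast
  ultimately show ?case using Suc.IH by (simp add: coord_restrict del: restrict_apply)
qed

lemma measurable_coord:
  assumes "\<And>i. sets (L i) = UNIV" "prod_encode (n, k) \<in> A"
  shows "coord n k \<in> measurable (PiM A L) (count_space UNIV)"
proof -
  have "(\<lambda>x. nat \<lfloor>x\<rfloor>) \<in> measurable (L (prod_encode (n, k))) (count_space UNIV)"
    by (rule measurableI) (simp_all add: assms(1))
  then show ?thesis
    unfolding coord_def[abs_def]
    by (rule measurable_compose[OF measurable_component_singleton[OF assms(2)]])
qed

lemma measurable_add_nat: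
  fixes f g :: "'a \<Rightarrow> nat"
  assumes "f \<in> measurable M (count_space UNIV)" "g \<in> measurable M (count_space UNIV)"
  shows "(\<lambda>\<omega>. f \<omega> + g \<omega>) \<in> measurable M (count_space UNIV)"
proof (rule measurable_compose_countable[OF _ assms(1)])
  show "(\<lambda>\<omega>. i + g \<omega>) \<in> measurable M (count_space UNIV)" for i
    by (rule measurable_compose[OF assms(2)]) simp
qed

lemma measurable_inar_path:
  assumes L: "\<And>i. sets (L i) = UNIV" and "past n \<subseteq> A"
  shows "inar_path n \<in> measurable (PiM A L) (count_space UNIV)"
  using assms(2)
proof (induction n)
  case 0
  then have "prod_encode (0, 0) \<in> A" by (auto simp: subset_iff)
  then show ?case using measurable_coord[of L, OF L] by simp
next
  case (Suc n)
  have in_A: "prod_encode (Suc n, k) \<in> A" for k using Suc.prems by (auto simp: subset_iff)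
  have "past n \<subseteq> A" using Suc.prems past_mono by blast
  then have "inar_path n \<in> measurable (PiM A L) (count_space UNIV)" by (rule Suc.IH)
  then have "(\<lambda>\<omega>. coord (Suc n) (Suc (inar_path n \<omega>)) \<omega>) \<in> measurable (PiM A L) (count_space UNIV)"
    by (rule measurable_compose_countable[rotated]) (intro measurable_coord[of L, OF L] in_A)
  then show ?case
    unfolding inar_path.simps by (intro measurable_add_nat measurable_coord[of L, OF L] in_A)
qed

text \<open>Preparing one binomial variable for each possible previous value makes the thinning a function of
the coordinates: the previous value only selects which of them is used, so conditionally on the value \<open>k\<close> the
thinning is Binomial(\<open>k\<close>, \<open>\<rho>\<close>). The innovation has a coordinate of its own, disjoint from all those which
enter the previous value and its thinning.\<close>
lemma stationary_INAR1_exists: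
  assumes \<rho>: "0 < \<rho>" "\<rho> < 1" and stationary: "p = add_pmf (thin_pmf \<rho> p) e"
  shows "\<exists>(M :: (nat \<Rightarrow> real) measure) X T \<epsilon>. INAR1 M \<rho> X T \<epsilon> \<and>
    (\<forall>n. distr M (count_space UNIV) (X n) = measure_pmf p)"
proof -
  define D where "D n k = (if n = 0 then p else case k of 0 \<Rightarrow> e | Suc j \<Rightarrow> binomial_pmf j \<rho>)"
    for n k :: nat
  define L where "L i = measure_pmf (map_pmf real (case_prod D (prod_decode i)))" for i
  define M where "M = PiM UNIV L"
  define X where "X = inar_path"
  define T where "T n \<omega> = coord n (Suc (X (n - 1) \<omega>)) \<omega>" for n \<omega>
  define \<epsilon> where "\<epsilon> n = coord n 0" for n
  have L: "prob_space (L i)" and sets_L: "sets (L i) = UNIV" for i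
    unfolding L_def by (auto intro: prob_space_measure_pmf)
  interpret prob_space M unfolding M_def by (intro prob_space_PiM L)
  note meas_coord = measurable_coord[of L, OF sets_L] and meas_path = measurable_inar_path[of L, OF sets_L]
  have coord_M [measurable]: "coord n k \<in> measurable M (count_space UNIV)" for n k
    unfolding M_def by (rule meas_coord) simp
  have X_M [measurable]: "X n \<in> measurable M (count_space UNIV)" for n
    unfolding M_def X_def by (rule meas_path) simp
  have T_M [measurable]: "T n \<in> measurable M (count_space UNIV)" for n
    unfolding T_def[abs_def] by (rule measurable_compose_countable) measurable
  have decode: "(\<lambda>x. nat \<lfloor>x\<rfloor>) \<in> measurable (L i) (count_space UNIV)" for i
    by (rule measurableI) (simp_all add: sets_L)
  have distr_coord: "distr M (count_space UNIV) (coord n k) = measure_pmf (D n k)" for n k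
  proof -
    have "distr M (count_space UNIV) (coord n k)
        = distr (distr M (L (prod_encode (n, k))) (\<lambda>\<omega>. \<omega> (prod_encode (n, k)))) (count_space UNIV) (\<lambda>x. nat \<lfloor>x\<rfloor>)"
      unfolding M_def coord_def[abs_def]
      by (subst distr_distr[OF decode]) (simp_all add: comp_def measurable_component_singleton)
    also have "\<dots> = distr (L (prod_encode (n, k))) (count_space UNIV) (\<lambda>x. nat \<lfloor>x\<rfloor>)"
      unfolding M_def by (subst distr_PiM_component) (auto intro: L)
    also have "\<dots> = measure_pmf (map_pmf (\<lambda>x. nat \<lfloor>x\<rfloor>) (map_pmf real (D n k)))"
      by (simp add: L_def map_pmf_rep_eq[symmetric] del: map_pmf_rep_eq)
    also have "\<dots> = measure_pmf (D n k)"
      by (simp add: pmf.map_comp comp_def)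
    finally show ?thesis .
  qed
  have distr_\<epsilon>: "distr M (count_space UNIV) (\<epsilon> (Suc n)) = measure_pmf e" for n
    by (simp add: \<epsilon>_def distr_coord D_def)

  have indep_thin: "indep_var (count_space UNIV) (X n) (count_space UNIV) (coord (Suc n) (Suc k))" for n k
    unfolding M_def X_def
    by (rule indep_var_PiM_disjoint[where A="past n" and B="{prod_encode (Suc n, Suc k)}"])
       (auto intro!: L meas_path meas_coord simp: inar_path_restrict coord_restrict)

  \<comment> \<open>The pair is encoded by one number because \<open>indep_var\<close> relates variables of a common value type.\<close>
  have indep_\<epsilon>: "indep_var (count_space UNIV) (\<epsilon> (Suc n)) (count_space UNIV) (\<lambda>\<omega>. prod_encode (X n \<omega>, T (Suc n) \<omega>))"
    and indep_\<epsilon>': "indep_var (count_space UNIV) (\<lambda>\<omega>. prod_encode (X n \<omega>, T (Suc n) \<omega>)) (count_space UNIV) (\<epsilon> (Suc n))" for n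
  proof -
    define A where "A = - {prod_encode (Suc n, 0)}"
    have disj: "A \<inter> {prod_encode (Suc n, 0)} = {}" "{prod_encode (Suc n, 0)} \<inter> A = {}"
      by (auto simp: A_def)
    have past: "past n \<subseteq> A" by (auto simp: A_def)
    have A: "prod_encode (Suc n, Suc k) \<in> A" for k by (simp add: A_def)
    have path: "inar_path n \<in> measurable (PiM A L) (count_space UNIV)" by (rule meas_path[OF past])
    have thin: "(\<lambda>\<omega>. prod_encode (k, coord (Suc n) (Suc k) \<omega>)) \<in> measurable (PiM A L) (count_space UNIV)" for k
      by (rule measurable_compose[OF meas_coord[OF A]]) simp
    have pair: "(\<lambda>\<omega>. prod_encode (X n \<omega>, T (Suc n) \<omega>)) \<in> measurable (PiM A L) (count_space UNIV)"
      using measurable_compose_countable[OF thin path] by (simp add: X_def T_def)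
    have pair_restrict: "prod_encode (X n (restrict \<omega> A), T (Suc n) (restrict \<omega> A)) = prod_encode (X n \<omega>, T (Suc n) \<omega>)" for \<omega>
      by (simp add: X_def T_def inar_path_restrict[OF past] coord_restrict[OF A] del: restrict_apply)
    have innov: "\<epsilon> (Suc n) \<in> measurable (PiM {prod_encode (Suc n, 0)} L) (count_space UNIV)"
      and innov_restrict: "\<epsilon> (Suc n) (restrict \<omega> {prod_encode (Suc n, 0)}) = \<epsilon> (Suc n) \<omega>" for \<omega>
      unfolding \<epsilon>_def by (simp_all add: meas_coord coord_restrict del: restrict_apply)
    show "indep_var (count_space UNIV) (\<epsilon> (Suc n)) (count_space UNIV) (\<lambda>\<omega>. prod_encode (X n \<omega>, T (Suc n) \<omega>))"
      unfolding M_def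
      by (rule indep_var_PiM_disjoint[OF L disj(2) innov innov_restrict pair pair_restrict])
    show "indep_var (count_space UNIV) (\<lambda>\<omega>. prod_encode (X n \<omega>, T (Suc n) \<omega>)) (count_space UNIV) (\<epsilon> (Suc n))"
      unfolding M_def
      by (rule indep_var_PiM_disjoint[OF L disj(1) pair pair_restrict innov innov_restrict])
  qed

  have step: "distr M (count_space UNIV) (X n) = measure_pmf p \<Longrightarrow>
      distr M (count_space UNIV) (T (Suc n)) = measure_pmf (thin_pmf \<rho> p)" for n
    using distr_mixture[where Y="X n" and Z="\<lambda>k. coord (Suc n) (Suc k)" and p=p and g="\<lambda>k. binomial_pmf k \<rho>"] indep_thin
    by (simp add: distr_coord D_def T_def[abs_def] thin_pmf_def)
  have distr_X: "distr M (count_space UNIV) (X n) = measure_pmf p" for n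
  proof (induction n)
    case 0
    have "X 0 = coord 0 0" by (simp add: X_def fun_eq_iff)
    then show ?case by (simp add: distr_coord D_def)
  next
    case (Suc n)
    have "indep_var (count_space UNIV) (snd \<circ> prod_decode \<circ> (\<lambda>\<omega>. prod_encode (X n \<omega>, T (Suc n) \<omega>))) (count_space UNIV) ((+) k \<circ> \<epsilon> (Suc n))" for k
      by (rule indep_var_compose[OF indep_\<epsilon>']) auto
    then have "indep_var (count_space UNIV) (T (Suc n)) (count_space UNIV) (\<lambda>\<omega>. k + \<epsilon> (Suc n) \<omega>)" for k
      by (simp add: comp_def)
    moreover have "distr M (count_space UNIV) (\<lambda>\<omega>. k + \<epsilon> (Suc n) \<omega>) = measure_pmf (map_pmf ((+) k) e)" for k
    proof -
      have "distr M (count_space UNIV) (\<lambda>\<omega>. k + \<epsilon> (Suc n) \<omega>)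
          = distr (distr M (count_space UNIV) (\<epsilon> (Suc n))) (count_space UNIV) ((+) k)"
        by (subst distr_distr) (auto simp: comp_def \<epsilon>_def)
      then show ?thesis by (simp add: distr_\<epsilon> map_pmf_rep_eq)
    qed
    ultimately have "distr M (count_space UNIV) (\<lambda>\<omega>. T (Suc n) \<omega> + \<epsilon> (Suc n) \<omega>)
        = measure_pmf (bind_pmf (thin_pmf \<rho> p) (\<lambda>x. map_pmf ((+) x) e))"
      by (intro distr_mixture step Suc.IH)
    also have "\<dots> = measure_pmf p" using stationary by (simp add: add_pmf_def)
    also have "(\<lambda>\<omega>. T (Suc n) \<omega> + \<epsilon> (Suc n) \<omega>) = X (Suc n)"
      by (simp add: X_def T_def \<epsilon>_def fun_eq_iff)
    finally show ?case .
  qed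

  have "INAR1 M \<rho> X T \<epsilon>"
    unfolding INAR1_def
  proof (intro conjI allI impI ballI)
    have "indep_vars (\<lambda>n. PiM {prod_encode (n, 0)} L) (\<lambda>n \<omega>. restrict \<omega> {prod_encode (n, 0)}) {1..}"
      unfolding M_def
      by (rule prob_space.indep_vars_restrict[OF _ indep_vars_PiM_coordinates])
         (auto intro: prob_space_PiM L simp: disjoint_family_on_def)
    then have "indep_vars (\<lambda>_. count_space UNIV) (\<lambda>n \<omega>. \<epsilon> n (restrict \<omega> {prod_encode (n, 0)})) {1..}"
      by (rule indep_vars_compose2) (auto simp: \<epsilon>_def intro: meas_coord)
    then show "indep_vars (\<lambda>_. count_space UNIV) \<epsilon> {1..}"
      unfolding \<epsilon>_def by (simp add: coord_restrict del: restrict_apply)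
  next
    fix n :: nat assume "1 \<le> n"
    then obtain m where m: "n = Suc m" by (cases n) auto
    show "distr M (count_space UNIV) (\<epsilon> n) = distr M (count_space UNIV) (\<epsilon> 1)"
      using distr_\<epsilon>[of m] distr_\<epsilon>[of 0] by (simp add: m)
    show "binomial_thinning M \<rho> (X (n - 1)) (T n)"
      unfolding binomial_thinning_def
    proof (intro conjI allI impI)
      fix k j assume pos: "measure M {\<omega> \<in> space M. X (n - 1) \<omega> = k} > 0"
      have "measure M {\<omega> \<in> space M. X m \<omega> = k} = pmf p k"
        using arg_cong[OF distr_X[of m], of "\<lambda>N. measure N {k}"]
        by (simp add: measure_distr measure_pmf_single vimage_def Int_def conj_commute)
      moreover have "measure M {\<omega> \<in> space M. T (Suc m) \<omega> = j \<and> X m \<omega> = k}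
          = pmf p k * pmf (binomial_pmf k \<rho>) j"
        using prob_mixture[where Y="X m" and Z="\<lambda>k. coord (Suc m) (Suc k)" and p=p and g="\<lambda>k. binomial_pmf k \<rho>" and j=j and k=k] indep_thin distr_X[of m]
        by (simp add: distr_coord D_def T_def)
      ultimately show "cond_prob M (\<lambda>\<omega>. T n \<omega> = j) (\<lambda>\<omega>. X (n - 1) \<omega> = k) = pmf (binomial_pmf k \<rho>) j"
        using pos by (simp add: cond_prob_def m del: pmf_binomial)
    qed measurable
    show "X n \<omega> = T n \<omega> + \<epsilon> n \<omega>" for \<omega>
      by (simp add: m X_def T_def \<epsilon>_def)
    have "indep_var (count_space UNIV) (\<epsilon> n) (count_space UNIV) (\<lambda>\<omega>. prod_encode (X (n - 1) \<omega>, T n \<omega>))"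
      using indep_\<epsilon>[of m] by (simp add: m)
    moreover have "(\<lambda>\<omega>. (X (n - 1) \<omega>, T n \<omega>)) -` B
        = (\<lambda>\<omega>. prod_encode (X (n - 1) \<omega>, T n \<omega>)) -` (prod_encode ` B)" for B
      by (auto simp: inj_image_mem_iff[OF inj_prod_encode])
    ultimately show "indep_set (range (\<lambda>A. \<epsilon> n -` A \<inter> space M))
        (range (\<lambda>B. (\<lambda>\<omega>. (X (n - 1) \<omega>, T n \<omega>)) -` B \<inter> space M))"
      unfolding indep_var_eq indep_set_def
      by (elim conjE indep_sets_mono_sets) (auto split: bool.split)
  qed (use \<rho> prob_space_axioms in auto)
  then show ?thesis using distr_X by blast
qed

section \<open>The convolution of a Bernoulli and a geometric law\<close>

definition marginal :: "nat pmf" where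
  "marginal = add_pmf (map_pmf of_bool (bernoulli_pmf (1 / 2))) (geometric_pmf (1 / 2))"

lemma cpgf_marginal:
  assumes "norm z \<le> 1"
  shows "cpgf marginal z = (1 + z) / (2 * (2 - z))"
proof -
  have "cpgf (map_pmf of_bool (bernoulli_pmf (1 / 2))) z = (1 + z) / 2"
    by (simp add: cpgf_def integral_measure_pmf[of UNIV] UNIV_bool scaleR_conv_of_real field_simps)
  moreover have "cpgf (geometric_pmf (1 / 2)) z = 1 / (2 - z)"
  proof -
    have "norm (z / 2) < 1" using assms by (simp add: norm_divide)
    then have "(\<lambda>k. 1 / 2 * (z / 2) ^ k) sums (1 / 2 * (1 / (1 - z / 2)))"
      by (intro sums_mult geometric_sums)
    moreover have "(\<lambda>k. of_real (pmf (geometric_pmf (1 / 2)) k) * z ^ k) = (\<lambda>k. 1 / 2 * (z / 2) ^ k)"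
      by (simp add: fun_eq_iff power_divide power_one_over)
    ultimately have "cpgf (geometric_pmf (1 / 2)) z = 1 / 2 * (1 / (1 - z / 2))"
      using cpgf_sums[OF assms, of "geometric_pmf (1 / 2)"] by (simp add: sums_unique2)
    moreover have "z \<noteq> 2" using assms by auto
    ultimately show ?thesis by (simp add: field_simps)
  qed
  ultimately show ?thesis
    unfolding marginal_def cpgf_add_pmf[OF assms]
    by (simp only: times_divide_times_eq mult_1_right)
qed

lemma pgf_marginal:
  assumes "\<bar>s\<bar> \<le> 1"
  shows "pgf marginal s = (1 + s) / (2 * (2 - s))"
proof -
  have "complex_of_real (pgf marginal s) = of_real ((1 + s) / (2 * (2 - s)))"
    using cpgf_marginal[of "of_real s"] assms by (simp add: cpgf_of_real)
  then show ?thesis by (simp only: of_real_eq_iff)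
qed

text \<open>The power series coefficients of \<open>(1 + s) * (4 - s) / ((5 + s) * (2 - s))\<close>, read off from its partial
fraction decomposition \<open>1 - (36/35) / (1 + s/5) + (3/7) / (1 - s/2)\<close>.\<close>
definition innovation_weight :: "nat \<Rightarrow> real" where
  "innovation_weight k = (if k = 0 then 1 else 0) - 36 / 35 * (- 1 / 5) ^ k + 3 / 7 * (1 / 2) ^ k"

definition innovation :: "nat pmf" where
  "innovation = embed_pmf innovation_weight"

lemma innovation_weight_sums:
  assumes "\<bar>s\<bar> \<le> 1"
  shows "(\<lambda>k. innovation_weight k * s ^ k) sums ((1 + s) * (4 - s) / ((5 + s) * (2 - s)))"
proof -
  have 1: "(\<lambda>k. if k = 0 then 1 else 0) sums (1::real)"
    using sums_single[of 0 "\<lambda>_. 1::real"] by simp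
  have 2: "(\<lambda>k. (- s / 5) ^ k) sums (1 / (1 - (- s / 5)))"
    using assms by (intro geometric_sums) auto
  have 3: "(\<lambda>k. (s / 2) ^ k) sums (1 / (1 - s / 2))"
    using assms by (intro geometric_sums) auto
  have "(\<lambda>k. (if k = 0 then 1 else 0) - 36 / 35 * (- s / 5) ^ k + 3 / 7 * (s / 2) ^ k)
      sums (1 - 36 / 35 * (1 / (1 - (- s / 5))) + 3 / 7 * (1 / (1 - s / 2)))"
    by (intro sums_add sums_diff sums_mult 1 2 3)
  also have "(\<lambda>k. (if k = 0 then 1 else 0) - 36 / 35 * (- s / 5) ^ k + 3 / 7 * (s / 2) ^ k)
      = (\<lambda>k. innovation_weight k * s ^ k)"
  proof
    fix k
    have "(- s / 5) ^ k = (- 1 / 5) ^ k * s ^ k" "(s / 2) ^ k = (1 / 2) ^ k * s ^ k"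
      by (simp_all flip: power_mult_distrib)
    then show "(if k = 0 then 1 else 0) - 36 / 35 * (- s / 5) ^ k + 3 / 7 * (s / 2) ^ k
        = innovation_weight k * s ^ k"
      by (simp add: innovation_weight_def algebra_simps)
  qed
  also have "1 - 36 / 35 * (1 / (1 - (- s / 5))) + 3 / 7 * (1 / (1 - s / 2))
      = (1 + s) * (4 - s) / ((5 + s) * (2 - s))"
  proof -
    have "s + 5 \<noteq> 0" "s \<noteq> 2" using assms by auto
    then show ?thesis by (simp add: divide_simps) (simp add: algebra_simps)
  qed
  finally show ?thesis .
qed

text \<open>This is where \<open>\<rho> = 1/3\<close> matters: the pole of the quotient at 2 must be sufficiently closer to 0 than the
one at \<open>1 - 2/\<rho> = -5\<close>, which produces alternating signs. With \<open>\<rho> = 1/2\<close> the coefficient of \<open>s\<^sup>2\<close> is negative.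
For \<open>k \<ge> 1\<close> the claim reduces to \<open>(2/5) ^ k \<le> 5/12\<close>.\<close>
lemma innovation_weight_nonneg: "0 \<le> innovation_weight k"
proof (cases k)
  case (Suc j)
  have "\<bar>(- 1 / 5 :: real) ^ k\<bar> = (1 / 2) ^ k * (2 / 5) ^ k"
    by (simp add: power_abs flip: power_mult_distrib)
  also have "\<dots> \<le> (1 / 2) ^ k * (2 / 5)"
    using power_decreasing[of 1 k "2 / 5 :: real"] Suc by (intro mult_left_mono) auto
  finally have "(- 1 / 5 :: real) ^ k \<le> 2 / 5 * (1 / 2) ^ k" by linarith
  moreover have "0 \<le> (1 / 2 :: real) ^ k" by simp
  ultimately have "0 \<le> - 36 / 35 * (- 1 / 5) ^ k + 3 / 7 * (1 / 2 :: real) ^ k" by linarith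
  then show ?thesis using Suc by (simp only: innovation_weight_def) simp
qed (simp add: innovation_weight_def)

lemma pmf_innovation: "pmf innovation k = innovation_weight k"
  unfolding innovation_def
proof (rule pmf_embed_pmf[OF innovation_weight_nonneg])
  have "innovation_weight sums 1"
    using innovation_weight_sums[of 1] by simp
  then show "(\<integral>\<^sup>+ k. ennreal (innovation_weight k) \<partial>count_space UNIV) = 1"
    using suminf_ennreal_eq[OF innovation_weight_nonneg] by (simp add: nn_integral_count_space_nat)
qed

lemma pgf_innovation:
  assumes "\<bar>s\<bar> \<le> 1"
  shows "pgf innovation s = (1 + s) * (4 - s) / ((5 + s) * (2 - s))"
  using sums_unique2[OF pgf_sums[OF assms, of innovation]] innovation_weight_sums[OF assms]
  by (simp add: pmf_innovation)

lemma marginal_stationary: "marginal = add_pmf (thin_pmf (1 / 3) marginal) innovation"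
proof (rule pgf_inj)
  fix s :: real assume s: "0 < s" "s < 1"
  have "pgf (add_pmf (thin_pmf (1 / 3) marginal) innovation) s
      = pgf marginal (1 - 1 / 3 + 1 / 3 * s) * pgf innovation s"
    using s by (intro pgf_add_thin) auto
  also have "\<dots> = (1 + s) / (2 * (2 - s))"
    using s by (simp add: pgf_marginal pgf_innovation divide_simps) (simp add: algebra_simps)
  finally show "pgf marginal s = pgf (add_pmf (thin_pmf (1 / 3) marginal) innovation) s"
    using s by (simp add: pgf_marginal)
qed

lemma char_marginal_pi: "char (law marginal) pi = 0"
  by (simp add: char_law cpgf_marginal)

lemma char_marginal_half_pi: "char (law marginal) (pi / 2) \<noteq> 0"
  by (simp add: char_law cpgf_marginal) (simp add: complex_eq_iff)

lemma marginal_not_infinitely_divisible: "\<not> discrete_infinitely_divisible marginal"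
  using infinitely_divisible_char_double[OF infinitely_divisible_law, of marginal "pi / 2"]
    char_marginal_pi char_marginal_half_pi by auto

text \<open>At \<open>-1\<close> the thinned factor takes the value of the generating function at \<open>1 - 2 * c\<close>, inside
\<open>(-1, 1)\<close>, where it is positive. So the zero at \<open>-1\<close> belongs to the factor \<open>q\<close>.\<close>
lemma marginal_not_discrete_SSD: "\<not> discrete_SSD c marginal"
proof
  assume "discrete_SSD c marginal"
  then obtain q where c: "0 < c" "c < 1" and q: "discrete_infinitely_divisible q"
    and eq: "\<forall>s\<in>{0<..<1}. pgf marginal s = pgf marginal (1 - c + c * s) * pgf q s"
    unfolding discrete_SSD_def by blast
  have "marginal = add_pmf (thin_pmf c marginal) q"
    using eq c by (intro pgf_inj) (simp add: pgf_add_thin)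
  then have char: "char (law marginal) t = cpgf marginal (1 - c + c * cis t) * char (law q) t" for t
    using c cpgf_add_pmf[of "cis t" "thin_pmf c marginal" q] cpgf_thin_pmf[of "cis t" c marginal]
    by (simp add: char_law)
  have "cpgf marginal (1 - c + c * cis pi) = of_real (pgf marginal (1 - 2 * c))"
    by (simp flip: cpgf_of_real)
  moreover have "pgf marginal (1 - 2 * c) \<noteq> 0"
    using c by (simp add: pgf_marginal)
  ultimately have "char (law q) pi = 0"
    using char[of pi] char_marginal_pi by simp
  then have "char (law q) (pi / 2) = 0"
    using infinitely_divisible_char_double[OF infinitely_divisible_law[OF q], of "pi / 2"] by auto
  then show False
    using char[of "pi / 2"] char_marginal_half_pi by simp
qed

section \<open>The counterexamples\<close>

theorem mainTheorem1:
  shows "(\<exists>\<rho>\<in>{0<..<1}. \<exists>(M :: (nat \<Rightarrow> real) measure) X \<epsilon> \<mu>.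
            AR1 M \<rho> X \<epsilon> \<and> (\<forall>n. distr M borel (X n) = \<mu>) \<and>
            \<not> infinitely_divisible \<mu> \<and> (\<forall>b\<in>{0<..<1}. \<not> SSD b \<mu>)) \<and>
         (\<exists>\<rho>\<in>{0<..<1}. \<exists>(M :: (nat \<Rightarrow> real) measure) X T \<epsilon> (p :: nat pmf).
            INAR1 M \<rho> X T \<epsilon> \<and> (\<forall>n. distr M (count_space UNIV) (X n) = measure_pmf p) \<and>
            \<not> discrete_infinitely_divisible p \<and> (\<forall>c\<in>{0<..<1}. \<not> discrete_SSD c p))"
proof (intro conjI)
  have "1 / 2 \<in> {0<..<1 :: real}" by simp
  moreover obtain M :: "(nat \<Rightarrow> real) measure" and X \<epsilon>
    where "AR1 M (1 / 2) X \<epsilon>" "\<And>n. distr M borel (X n) = unif"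
    using stationary_AR1_exists[OF real_distribution_unif real_distribution_half_coin _ _
        char_unif_recursion] by auto
  moreover have "\<not> infinitely_divisible unif"
    using infinitely_divisible_char_double[of unif pi] char_unif_2pi char_unif_nonzero[of pi] by auto
  moreover have "\<not> SSD b unif" if "b \<in> {0<..<1}" for b
    using not_SSD_if_first_char_zero[of b pi unif] that char_unif_2pi char_unif_nonzero by auto
  ultimately show "\<exists>\<rho>\<in>{0<..<1}. \<exists>(M :: (nat \<Rightarrow> real) measure) X \<epsilon> \<mu>.
      AR1 M \<rho> X \<epsilon> \<and> (\<forall>n. distr M borel (X n) = \<mu>) \<and>
      \<not> infinitely_divisible \<mu> \<and> (\<forall>b\<in>{0<..<1}. \<not> SSD b \<mu>)"
    by blast
next
  have "1 / 3 \<in> {0<..<1 :: real}" by simp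
  moreover obtain M :: "(nat \<Rightarrow> real) measure" and X T \<epsilon>
    where "INAR1 M (1 / 3) X T \<epsilon>" "\<And>n. distr M (count_space UNIV) (X n) = measure_pmf marginal"
    using stationary_INAR1_exists[OF _ _ marginal_stationary] by auto
  ultimately show "\<exists>\<rho>\<in>{0<..<1}. \<exists>(M :: (nat \<Rightarrow> real) measure) X T \<epsilon> (p :: nat pmf).
      INAR1 M \<rho> X T \<epsilon> \<and> (\<forall>n. distr M (count_space UNIV) (X n) = measure_pmf p) \<and>
      \<not> discrete_infinitely_divisible p \<and> (\<forall>c\<in>{0<..<1}. \<not> discrete_SSD c p)"
    using marginal_not_infinitely_divisible marginal_not_discrete_SSD by blast
qed

end
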